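(* Let $A$ and $B$ be arbitrary, possibly infinite, non-empty sets. For any set $\mathcal{T}$ of generalized constraints from $A$ to $B$, the following two conditions are equivalent: (i) $\mathcal{T}$ is locally closed and contains the binary generalized equality constraint and the unary generalized empty constraint, and it is closed under formation of conjunctive minors and taking the limit of antecedents. (ii) $\mathcal{T}$ is characterized by some set of functions of several variables from $A$ to $B$.
   Context: $\mathbb{N}$ is the set of nonnegative integers; $m\in\mathbb{N}$ is identified with $\{0,\dots,m-1\}$, and an $m$-tuple over $A$ is a map $m\to A$. A function of several variables from $A$ to $B$ is a map $f\colon A^n\to B$, $n\ge1$. An $m\times n$ matrix over $A$ is an $n$-tuple $\mathbf{M}=(\mathbf{a}^1,\dots,\mathbf{a}^n)$ of $m$-tuples over $A$ (its columns); $f\mathbf{M}\in B^m$ is the $m$-tuple $i\mapsto f(\mathbf{a}^1(i),\dots,\mathbf{a}^n(i))$. Generalized constraints. For an integer $m\ge1$, an $m$-ary repetition function on $A$ is a map $\phi\colon A^m\to\mathbb{N}\cup\{\infty\}$; these are ordered pointwise. An $m$-ary generalized constraint from $A$ to $B$ is a pair $(\phi,S)$ with $\phi$ an $m$-ary repetition function on $A$ (antecedent) and $S\subseteq B^m$ (consequent). $\mathbf{M}\prec\phi$ means that each $\mathbf{a}\in A^m$ occurs as a column of $\mathbf{M}$ at most $\phi(\mathbf{a})$ times. $f\colon A^n\to B$ satisfies $(\phi,S)$ if $f\mathbf{M}\in S$ for every $m\times n$ matrix $\mathbf{M}\prec\phi$. $\mathcal{T}$ is characterized by a set $\mathcal{C}$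 of functions if $\mathcal{T}$ is precisely the set of generalized constraints from $A$ to $B$ satisfied by all functions in $\mathcal{C}$. Special constraints. The binary generalized equality constraint is $(\phi,S)$ with $\phi(a,b)=\infty$ if $a=b$, $\phi(a,b)=0$ otherwise, and $S=\{(b,b):b\in B\}$. The unary generalized empty constraint is $(\phi,\emptyset)$ with $\phi(a)=0$ for all $a\in A$. Local closure. $(\phi',S)$ is obtained from $(\phi,S)$ by a finite restriction of the antecedent if $\phi'\le\phi$ and $\{\mathbf{a}\in A^m:\phi'(\mathbf{a})\ne0\}$ is finite. $\mathcal{T}$ is locally closed if every generalized constraint $(\phi,S)$ belongs to $\mathcal{T}$ whenever all generalized constraints obtained from $(\phi,S)$ by a finite restriction of the antecedent belong to $\mathcal{T}$. Limits. For a nondecreasing sequence $a_0\le a_1\le\cdots$ in $\mathbb{N}\cup\{\infty\}$, $\lim a_i$ is its maximum element if there is one, and $\infty$ otherwise; for $\phi_0\le\phi_1\le\cdots$ the limit is taken pointwise. $\mathcal{T}$ is closed under taking the limit of antecedents if, whenever $(\phi_i,S)_{i\in\mathbb{N}}$ is a family of members of $\mathcal{T}$ with $\phi_i\le\phi_{i+1}$ for all $i$, also $(\lim_{i\to\infty}\phi_i,S)\in\mathcal{T}$. Conjunctive minors. A minor formation scheme with target $m$ (a positive integer), indeterminate set $V$ (an arbitrary set disjoint from the ordinals) and source family $(n_j)_{j\in J}$ (positive integers) is a non-empty family $H=(h_j)_{j\in J}$ of maps $h_j\colon n_j\to m\cup V$. A Skolem map is any map $\sigma\colon V\to A$ (or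 $V\to B$, when working over $B$). For an $m$-tuple $\mathbf{a}$, $\mathbf{a}+\sigma$ is the map on $m\cup V$ equal to $\mathbf{a}$ on $m$ and to $\sigma$ on $V$; $(\mathbf{a}+\sigma)h_j$ is the $n_j$-tuple $(\mathbf{a}+\sigma)\circ h_j$. Let $(\phi_j,S_j)_{j\in J}$ be a family of generalized constraints from $A$ to $B$, with $(\phi_j,S_j)$ of arity $n_j$. An $m$-ary generalized constraint $(\phi,S)$ is a conjunctive minor of this family via $H$ if: (1) ($\phi$ is a restrictive conjunctive minor of $(\phi_j)_{j\in J}$ via $H$) for every $n$ and every $m\times n$ matrix $\mathbf{M}=(\mathbf{a}^1,\dots,\mathbf{a}^n)$ over $A$ with $\mathbf{M}\prec\phi$, there are Skolem maps $\sigma_1,\dots,\sigma_n\colon V\to A$ such that $((\mathbf{a}^1+\sigma_1)h_j,\dots,(\mathbf{a}^n+\sigma_n)h_j)\prec\phi_j$ for all $j\in J$; and (2) ($S$ is an extensive conjunctive minor of $(S_j)_{j\in J}$ via $H$) for every $\mathbf{b}\in B^m$, if there is a Skolem map $\sigma\colon V\to B$ with $(\mathbf{b}+\sigma)h_j\in S_j$ for all $j\in J$, then $\mathbf{b}\in S$. $\mathcal{T}$ is closed under formation of conjunctive minors if all conjunctive minors (via any scheme) of non-empty families of members of $\mathcal{T}$ are in $\mathcal{T}$. *)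

theory Defs
  imports Main "HOL-Library.Extended_Nat" "HOL-Library.FuncSet"
begin

text \<open>
  The sets \<open>A\<close> and \<open>B\<close> are the types \<open>'a\<close> and \<open>'b\<close> (HOL types are non-empty, and otherwise of
  arbitrary cardinality).  An \<open>m\<close>-tuple is a list of length \<open>m\<close>, with components \<open>a ! 0, \<dots>, a ! (m - 1)\<close>;
  an \<open>m \<times> n\<close> matrix is the list of its \<open>n\<close> columns, each an \<open>m\<close>-tuple.
\<close>

definition tuples :: "nat \<Rightarrow> 'a list set" where
  "tuples m = {a. length a = m}"

definition matrices :: "nat \<Rightarrow> nat \<Rightarrow> 'a list list set" where
  "matrices m n = {M. length M = n \<and> set M \<subseteq> tuples m}"


subsection \<open>Functions of several variables\<close>

text \<open>
  The pair \<open>(n, f)\<close> is the function \<open>f : A\<^sup>n \<rightarrow> B\<close>; it is extensional, so that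
  distinct pairs are distinct functions.
\<close>

type_synonym ('a, 'b) mfun = "nat \<times> ('a list \<Rightarrow> 'b)"

definition several_variable_funs :: "('a, 'b) mfun set" where
  "several_variable_funs = {(n, f). n \<ge> 1 \<and> f \<in> extensional (tuples n)}"

definition apply_rows :: "('a list \<Rightarrow> 'b) \<Rightarrow> nat \<Rightarrow> 'a list list \<Rightarrow> 'b list" where
  "apply_rows f m M = map (\<lambda>i. f (map (\<lambda>a. a ! i) M)) [0..<m]"


subsection \<open>Generalized constraints\<close>

text \<open>
  A repetition function \<open>A\<^sup>m \<rightarrow> \<nat> \<union> {\<infinity>}\<close> is encoded as a function on all lists which is \<open>0\<close>
  outside \<open>A\<^sup>m\<close>, so that the encoding is unique and pointwise comparison over all lists is the
  pointwise order over \<open>A\<^sup>m\<close>.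
\<close>

definition repetition_function :: "nat \<Rightarrow> ('a list \<Rightarrow> enat) \<Rightarrow> bool" where
  "repetition_function m \<phi> \<longleftrightarrow> (\<forall>a. a \<notin> tuples m \<longrightarrow> \<phi> a = 0)"

datatype ('a, 'b) gconstraint =
  GConstraint (arity: nat) (antecedent: "'a list \<Rightarrow> enat") (consequent: "'b list set")

definition generalized_constraint :: "('a, 'b) gconstraint \<Rightarrow> bool" where
  "generalized_constraint c \<longleftrightarrow>
     arity c \<ge> 1 \<and> repetition_function (arity c) (antecedent c) \<and> consequent c \<subseteq> tuples (arity c)"

definition matrix_prec :: "'a list list \<Rightarrow> ('a list \<Rightarrow> enat) \<Rightarrow> bool" (infix "\<prec>\<^sub>m" 50) where
  "M \<prec>\<^sub>m \<phi> \<longleftrightarrow> (\<forall>a. enat (count_list M a) \<le> \<phi> a)"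

definition satisfies :: "('a, 'b) mfun \<Rightarrow> ('a, 'b) gconstraint \<Rightarrow> bool" where
  "satisfies g c \<longleftrightarrow>
     (\<forall>M \<in> matrices (arity c) (fst g).
        M \<prec>\<^sub>m antecedent c \<longrightarrow> apply_rows (snd g) (arity c) M \<in> consequent c)"

definition characterized_by :: "('a, 'b) gconstraint set \<Rightarrow> ('a, 'b) mfun set \<Rightarrow> bool" where
  "characterized_by T C \<longleftrightarrow> T = {c. generalized_constraint c \<and> (\<forall>g \<in> C. satisfies g c)}"

definition binary_equality_constraint :: "('a, 'b) gconstraint" where
  "binary_equality_constraint =
     GConstraint 2 (\<lambda>t. if \<exists>a. t = [a, a] then \<infinity> else 0) {[b, b] | b. True}"

definition unary_empty_constraint :: "('a, 'b) gconstraint" where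
  "unary_empty_constraint = GConstraint 1 (\<lambda>_. 0) {}"


subsection \<open>Local closure and limits of antecedents\<close>

definition finite_restriction :: "('a, 'b) gconstraint \<Rightarrow> ('a, 'b) gconstraint \<Rightarrow> bool" where
  "finite_restriction c' c \<longleftrightarrow>
     generalized_constraint c' \<and> arity c' = arity c \<and> consequent c' = consequent c \<and>
     antecedent c' \<le> antecedent c \<and> finite {a \<in> tuples (arity c). antecedent c' a \<noteq> 0}"

definition locally_closed :: "('a, 'b) gconstraint set \<Rightarrow> bool" where
  "locally_closed T \<longleftrightarrow>
     (\<forall>c. generalized_constraint c \<longrightarrow> (\<forall>c'. finite_restriction c' c \<longrightarrow> c' \<in> T) \<longrightarrow> c \<in> T)"

definition enat_lim :: "(nat \<Rightarrow> enat) \<Rightarrow> enat" where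
  "enat_lim s = (if \<exists>i. \<forall>j. s j \<le> s i then (GREATEST x. x \<in> range s) else \<infinity>)"

definition closed_under_limits :: "('a, 'b) gconstraint set \<Rightarrow> bool" where
  "closed_under_limits T \<longleftrightarrow>
     (\<forall>m (\<phi> :: nat \<Rightarrow> 'a list \<Rightarrow> enat) S.
        (\<forall>i. GConstraint m (\<phi> i) S \<in> T) \<longrightarrow> (\<forall>i. \<phi> i \<le> \<phi> (Suc i)) \<longrightarrow>
        GConstraint m (\<lambda>a. enat_lim (\<lambda>i. \<phi> i a)) S \<in> T)"

lemma enat_lim_eq_SUP: "enat_lim s = (SUP i. s i)"
proof (cases "\<exists>i. \<forall>j. s j \<le> s i")
  case True
  then obtain i where i: "\<forall>j. s j \<le> s i" by blast
  have "(GREATEST x. x \<in> range s) = s i"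
    by (rule Greatest_equality) (use i in auto)
  moreover have "(SUP i. s i) = s i"
    by (rule antisym) (use i in \<open>auto intro: SUP_least SUP_upper\<close>)
  ultimately show ?thesis using True by (simp add: enat_lim_def)
next
  case False
  have "infinite (range s)"
  proof
    assume fin: "finite (range s)"
    then have "Max (range s) \<in> range s" by (intro Max_in) auto
    then obtain i where "s i = Max (range s)" by auto
    with fin False show False by (metis Max_ge rangeI)
  qed
  then have "(SUP i. s i) = \<infinity>" by (simp add: Sup_enat_def)
  moreover have "enat_lim s = \<infinity>" unfolding enat_lim_def using False by (rule if_not_P)
  ultimately show ?thesis by simp
qed


subsection \<open>Conjunctive minors\<close>

text \<open>
  The disjoint union \<open>m \<union> V\<close> is rendered with the sum type: \<open>Inl i\<close> for \<open>i < m\<close> and \<open>Inr v\<close> for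
  \<open>v \<in> V\<close>.  The map \<open>h j : n\<^sub>j \<rightarrow> m \<union> V\<close> is the list of its values, so \<open>n\<^sub>j = length (h j)\<close>, and
  composition with \<open>h j\<close> is \<open>map\<close>.  Skolem maps are taken total on the indeterminate type;
  only their values on \<open>V\<close> are ever used.
\<close>

definition minor_scheme :: "nat \<Rightarrow> 'v set \<Rightarrow> 'j set \<Rightarrow> ('j \<Rightarrow> (nat + 'v) list) \<Rightarrow> bool" where
  "minor_scheme m V J h \<longleftrightarrow>
     m \<ge> 1 \<and> J \<noteq> {} \<and> (\<forall>j \<in> J. length (h j) \<ge> 1 \<and> set (h j) \<subseteq> {..<m} <+> V)"

definition extend_tuple :: "'a list \<Rightarrow> ('v \<Rightarrow> 'a) \<Rightarrow> nat + 'v \<Rightarrow> 'a" (infixl "+\<^sub>t" 65) where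
  "a +\<^sub>t \<sigma> = case_sum (\<lambda>i. a ! i) \<sigma>"

definition restrictive_minor ::
  "nat \<Rightarrow> 'j set \<Rightarrow> ('j \<Rightarrow> (nat + 'v) list) \<Rightarrow> ('a list \<Rightarrow> enat) \<Rightarrow> ('j \<Rightarrow> 'a list \<Rightarrow> enat) \<Rightarrow> bool" where
  "restrictive_minor m J h \<phi> \<psi> \<longleftrightarrow>
     (\<forall>n. \<forall>M \<in> matrices m n. M \<prec>\<^sub>m \<phi> \<longrightarrow>
        (\<exists>\<sigma> :: nat \<Rightarrow> 'v \<Rightarrow> 'a. \<forall>j \<in> J.
           map (\<lambda>k. map (M ! k +\<^sub>t \<sigma> k) (h j)) [0..<n] \<prec>\<^sub>m \<psi> j))"

definition extensive_minor ::
  "nat \<Rightarrow> 'j set \<Rightarrow> ('j \<Rightarrow> (nat + 'v) list) \<Rightarrow> 'b list set \<Rightarrow> ('j \<Rightarrow> 'b list set) \<Rightarrow> bool" where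
  "extensive_minor m J h S R \<longleftrightarrow>
     (\<forall>b \<in> tuples m. (\<exists>\<sigma> :: 'v \<Rightarrow> 'b. \<forall>j \<in> J. map (b +\<^sub>t \<sigma>) (h j) \<in> R j) \<longrightarrow> b \<in> S)"

definition conjunctive_minor ::
  "'v set \<Rightarrow> 'j set \<Rightarrow> ('j \<Rightarrow> (nat + 'v) list) \<Rightarrow>
   ('j \<Rightarrow> ('a, 'b) gconstraint) \<Rightarrow> ('a, 'b) gconstraint \<Rightarrow> bool" where
  "conjunctive_minor V J h c d \<longleftrightarrow>
     minor_scheme (arity d) V J h \<and> generalized_constraint d \<and>
     (\<forall>j \<in> J. generalized_constraint (c j) \<and> arity (c j) = length (h j)) \<and>
     restrictive_minor (arity d) J h (antecedent d) (\<lambda>j. antecedent (c j)) \<and>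
     extensive_minor (arity d) J h (consequent d) (\<lambda>j. consequent (c j))"

text \<open>
  In the mathematics \<open>V\<close> and \<open>J\<close> range over arbitrary sets, whereas a HOL formula can only quantify
  over subsets of fixed types.  The types below are large enough for this to be no restriction: by
  \<open>closed_under_conjunctive_minorsD\<close>, closure for
  these types implies closure for indeterminates and indices of any types whatsoever.
\<close>

type_synonym 'a indet = "'a list list \<times> nat \<Rightarrow> 'a"

type_synonym ('a, 'b) index = "(nat + 'a indet) list \<times> ('a, 'b) gconstraint"

definition closed_under_conjunctive_minors :: "('a, 'b) gconstraint set \<Rightarrow> bool" where
  "closed_under_conjunctive_minors T \<longleftrightarrow>
     (\<forall>(V :: 'a indet set) (J :: ('a, 'b) index set) h c d.
        (\<forall>j \<in> J. c j \<in> T) \<longrightarrow> conjunctive_minor V J h c d \<longrightarrow> d \<in> T)"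

lemma closed_under_conjunctive_minorsD:
  fixes T :: "('a, 'b) gconstraint set" and V :: "'v set" and J :: "'j set"
  assumes T: "closed_under_conjunctive_minors T"
    and c: "\<forall>j \<in> J. c j \<in> T" and minor: "conjunctive_minor V J h c d"
  shows "d \<in> T"
proof -
  let ?m = "arity d"
  define P :: "'a list list \<Rightarrow> (nat \<Rightarrow> 'v \<Rightarrow> 'a) \<Rightarrow> bool" where
    "P M \<sigma> \<longleftrightarrow> (\<forall>j \<in> J. map (\<lambda>k. map (M ! k +\<^sub>t \<sigma> k) (h j)) [0..<length M] \<prec>\<^sub>m antecedent (c j))"
    for M \<sigma>
  have restr: "restrictive_minor ?m J h (antecedent d) (\<lambda>j. antecedent (c j))"
    and extens: "extensive_minor ?m J h (consequent d) (\<lambda>j. consequent (c j))"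
    using minor by (simp_all add: conjunctive_minor_def)
  define \<Sigma> where "\<Sigma> M = (SOME \<sigma>. P M \<sigma>)" for M
  have \<Sigma>: "P M (\<Sigma> M)" if "M \<in> matrices ?m n" "M \<prec>\<^sub>m antecedent d" for M n
  proof -
    have "length M = n" using that(1) by (simp add: matrices_def)
    then have "\<exists>\<sigma>. P M \<sigma>"
      using restr[unfolded restrictive_minor_def, rule_format, OF that] by (simp add: P_def)
    then show ?thesis unfolding \<Sigma>_def by (rule someI_ex)
  qed
  define q :: "'v \<Rightarrow> 'a indet" where "q v = (\<lambda>(M, k). \<Sigma> M k v)" for v
  define h' where "h' j = map (map_sum id q) (h j)" for j
  define J' where "J' = (\<lambda>j. (h' j, c j)) ` J"
  have ext: "(a +\<^sub>t \<tau>) \<circ> map_sum id q = a +\<^sub>t (\<tau> \<circ> q)"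
    for a :: "'c list" and \<tau> :: "'a indet \<Rightarrow> 'c"
    by (auto simp: extend_tuple_def fun_eq_iff split: sum.splits)
  have "conjunctive_minor (q ` V) J' fst snd d"
    unfolding conjunctive_minor_def
  proof (intro conjI)
    show "minor_scheme ?m (q ` V) J' fst"
    proof -
      have sub: "map_sum id q ` X \<subseteq> {..<?m} <+> q ` V" if "X \<subseteq> {..<?m} <+> V" for X
        using that by force
      have "minor_scheme ?m V J h" using minor by (simp add: conjunctive_minor_def)
      then show ?thesis by (auto simp: minor_scheme_def J'_def h'_def sub[THEN subsetD])
    qed
    show "generalized_constraint d" using minor by (simp add: conjunctive_minor_def)
    show "\<forall>j \<in> J'. generalized_constraint (snd j) \<and> arity (snd j) = length (fst j)"
      using minor by (auto simp: conjunctive_minor_def J'_def h'_def)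
    show "restrictive_minor ?m J' fst (antecedent d) (\<lambda>j. antecedent (snd j))"
      unfolding restrictive_minor_def
    proof (intro allI ballI impI)
      fix n M assume M: "M \<in> matrices ?m n" "M \<prec>\<^sub>m antecedent d"
      then have n: "n = length M" by (simp add: matrices_def)
      have q: "(\<lambda>w. w (M, k)) \<circ> q = \<Sigma> M k" for k
        by (simp add: q_def fun_eq_iff)
      show "\<exists>\<sigma> :: nat \<Rightarrow> 'a indet \<Rightarrow> 'a. \<forall>j \<in> J'.
          map (\<lambda>k. map (M ! k +\<^sub>t \<sigma> k) (fst j)) [0..<n] \<prec>\<^sub>m antecedent (snd j)"
        by (rule exI[of _ "\<lambda>k w. w (M, k)"])
          (use \<Sigma>[OF M] in \<open>simp add: P_def J'_def h'_def ext q n\<close>)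
    qed
    show "extensive_minor ?m J' fst (consequent d) (\<lambda>j. consequent (snd j))"
      unfolding extensive_minor_def
    proof (intro ballI impI)
      fix b :: "'b list"
      assume b: "b \<in> tuples ?m"
        and "\<exists>\<sigma> :: 'a indet \<Rightarrow> 'b. \<forall>j \<in> J'. map (b +\<^sub>t \<sigma>) (fst j) \<in> consequent (snd j)"
      then obtain \<sigma> :: "'a indet \<Rightarrow> 'b"
        where "\<forall>j \<in> J'. map (b +\<^sub>t \<sigma>) (fst j) \<in> consequent (snd j)" by blast
      then have "\<forall>j \<in> J. map (b +\<^sub>t (\<sigma> \<circ> q)) (h j) \<in> consequent (c j)"
        by (simp add: J'_def h'_def ext)
      with extens[unfolded extensive_minor_def, rule_format, OF b]
      show "b \<in> consequent d" by auto
    qed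
  qed
  moreover have "\<forall>j \<in> J'. snd j \<in> T" using c by (auto simp: J'_def)
  ultimately show ?thesis
    using T[unfolded closed_under_conjunctive_minors_def, THEN spec[of _ "q ` V"],
        THEN spec[of _ J'], THEN spec[of _ fst], THEN spec[of _ snd], THEN spec[of _ d]]
    by blast
qed

end

theory Submission
  imports Defs "HOL-Library.Multiset" "HOL-Combinatorics.Permutations"
begin

text \<open>
  The interesting direction is to separate a constraint \<open>(\<phi>, S) \<notin> T\<close> from \<open>T\<close> by a function. Local
  closure and limits of antecedents reduce this to a \<open>\<phi>\<close> with finite values and finite support, so
  that \<open>\<phi>\<close> counts the columns of a single matrix \<open>D\<close> with, say, \<open>N\<close> columns; the empty constraint
  rules out \<open>N = 0\<close>. Use the elements of \<open>A\<^sup>N\<close> as indeterminates: a Skolem map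
  \<open>A\<^sup>N \<rightarrow> B\<close> then is an \<open>N\<close>-ary function. Imposing each constraint \<open>c \<in> T\<close> on the rows of each
  matrix with \<open>N\<close> columns that respects the antecedent of \<open>c\<close> says that this function satisfies
  all of \<open>T\<close>, and equality constraints tie the target to the rows of \<open>D\<close>. If every such function
  mapped \<open>D\<close> into \<open>S\<close>, then \<open>(\<phi>, S)\<close> would be a conjunctive minor of members of \<open>T\<close>. The
  antecedent condition holds because a matrix respecting \<open>\<phi>\<close> is a selection of columns of \<open>D\<close>,
  and the coordinate projections \<open>A\<^sup>N \<rightarrow> A\<close> are the required Skolem maps.
\<close>

section \<open>Multiplicities of list entries and selections of entries\<close>

lemma count_list_conv_card: "count_list xs x = card {i. i < length xs \<and> xs ! i = x}"
  by (simp add: count_list_eq_length_filter length_filter_conv_card eq_commute)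

text \<open>As a multiset, \<open>xs\<close> is contained in \<open>ys\<close>, so it is an initial
  segment of a rearrangement of \<open>ys\<close>. The rearranging permutation, restricted to the
  indices of \<open>xs\<close>, is the injection.\<close>

lemma obtain_injection_of_count_list_le:
  assumes "\<And>x. count_list xs x \<le> count_list ys x"
  obtains \<pi> where "inj_on \<pi> {..<length xs}" "\<And>i. i < length xs \<Longrightarrow> \<pi> i < length ys"
    "\<And>i. i < length xs \<Longrightarrow> xs ! i = ys ! \<pi> i"
proof -
  have "mset xs \<subseteq># mset ys"
    using assms by (simp add: subseteq_mset_def count_mset)
  then obtain zs where "mset (xs @ zs) = mset ys"
    by (metis ex_mset mset_append mset_subset_eq_exists_conv)
  then obtain p where p: "p permutes {..<length ys}" "permute_list p ys = xs @ zs"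
    using mset_eq_permutation by blast
  have len: "length xs \<le> length ys"
    using p(2) by (metis length_append length_permute_list le_add1)
  show thesis
  proof
    show "inj_on p {..<length xs}"
      using p(1) by (meson inj_on_subset permutes_inj subset_UNIV)
    fix i assume i: "i < length xs"
    then have "i < length ys" using len by simp
    then show "p i < length ys" using p(1) by (metis lessThan_iff permutes_in_image)
    show "xs ! i = ys ! p i"
      using permute_list_nth[OF p(1) \<open>i < length ys\<close>] p(2) i by (simp add: nth_append)
  qed
qed

lemma count_list_select_le:
  assumes "inj_on \<pi> {..<n}" "\<And>i. i < n \<Longrightarrow> \<pi> i < length ys"
  shows "count_list (map (\<lambda>i. ys ! \<pi> i) [0..<n]) x \<le> count_list ys x"
proof -
  have "card {i. i < n \<and> ys ! \<pi> i = x} \<le> card {i. i < length ys \<and> ys ! i = x}"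
    by (rule card_inj_on_le[of \<pi>]) (use assms in \<open>auto intro: inj_on_subset\<close>)
  moreover have "{i. i < length (map (\<lambda>i. ys ! \<pi> i) [0..<n]) \<and>
      map (\<lambda>i. ys ! \<pi> i) [0..<n] ! i = x} = {i. i < n \<and> ys ! \<pi> i = x}"
    by auto
  ultimately show ?thesis by (simp only: count_list_conv_card)
qed

lemma obtain_list_of_counts:
  assumes "finite {x. c x \<noteq> (0 :: nat)}"
  obtains xs where "\<And>x. count_list xs x = c x"
proof -
  obtain xs where "mset xs = Abs_multiset c" using ex_mset by blast
  moreover have "count (Abs_multiset c) = c" using assms by (simp add: Abs_multiset_inverse)
  ultimately show thesis using that by (metis count_mset)
qed

section \<open>Closure properties of the constraints satisfied by a function\<close>

lemma matrix_prec_nonzero: "M \<prec>\<^sub>m \<phi> \<Longrightarrow> a \<in> set M \<Longrightarrow> \<phi> a \<noteq> 0"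
  by (metis matrix_prec_def count_list_0_iff ile0_eq enat_0_iff(1))

lemma satisfies_binary_equality: "satisfies g binary_equality_constraint"
  unfolding satisfies_def
proof (intro ballI impI)
  fix M assume "M \<prec>\<^sub>m antecedent (binary_equality_constraint :: ('a, 'b) gconstraint)"
  then have "\<exists>x. a = [x, x]" if "a \<in> set M" for a
    using matrix_prec_nonzero[OF _ that]
    by (force simp: binary_equality_constraint_def split: if_splits)
  then have "map (\<lambda>a. a ! 0) M = map (\<lambda>a. a ! Suc 0) M" by fastforce
  then show "apply_rows (snd g) (arity binary_equality_constraint) M
      \<in> consequent binary_equality_constraint"
    by (simp add: binary_equality_constraint_def apply_rows_def numeral_2_eq_2 del: map_eq_conv)
qed

text \<open>Only the matrix without columns respects a zero antecedent, and a positive arity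
  excludes it.\<close>

lemma satisfies_unary_empty: "fst g \<ge> 1 \<Longrightarrow> satisfies g unary_empty_constraint"
  unfolding satisfies_def unary_empty_constraint_def matrices_def
  using matrix_prec_nonzero by (fastforce simp: Suc_le_length_iff)

text \<open>A matrix has finitely many columns, so it already respects the antecedent cut down to
  its own columns.\<close>

lemma satisfies_if_finite_restrictions:
  assumes c: "generalized_constraint c"
    and sat: "\<And>c'. finite_restriction c' c \<Longrightarrow> satisfies g c'"
  shows "satisfies g c"
  unfolding satisfies_def
proof (intro ballI impI)
  fix M assume M: "M \<in> matrices (arity c) (fst g)" "M \<prec>\<^sub>m antecedent c"
  let ?c = "GConstraint (arity c) (\<lambda>a. if a \<in> set M then antecedent c a else 0) (consequent c)"
  have "finite {a \<in> tuples (arity c). antecedent ?c a \<noteq> 0}"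
    by (rule finite_subset[of _ "set M"]) auto
  then have "finite_restriction ?c c"
    using c by (auto simp: finite_restriction_def generalized_constraint_def
        repetition_function_def le_fun_def)
  then have "satisfies g ?c" by (rule sat)
  moreover have "M \<prec>\<^sub>m antecedent ?c"
    using M(2) by (auto simp: matrix_prec_def zero_enat_def)
  ultimately show "apply_rows (snd g) (arity c) M \<in> consequent c"
    using M(1) by (simp add: satisfies_def)
qed

text \<open>Each column has a finite multiplicity, reached at some stage even where the limit is
  \<open>\<infinity>\<close>. There are finitely many distinct columns, so one late stage serves
  them all.\<close>

lemma matrix_prec_limit:
  assumes mono: "\<And>i. \<phi> i \<le> \<phi> (Suc i)" and M: "M \<prec>\<^sub>m (\<lambda>a. enat_lim (\<lambda>i. \<phi> i a))"
  obtains i where "M \<prec>\<^sub>m \<phi> i"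
proof -
  have le: "i \<le> j \<Longrightarrow> \<phi> i a \<le> \<phi> j a" for i j a
    using lift_Suc_mono_le[of \<phi>, OF mono] by (simp add: le_fun_def)
  have "\<exists>i. enat (count_list M a) \<le> \<phi> i a" if "a \<in> set M" for a
  proof -
    \<comment> \<open>Only a strict bound below a supremum passes to a member, so the count is
      lowered by one here. It is restored below, being positive for a column of
      \<open>M\<close>.\<close>
    have "enat (count_list M a - 1) < (SUP i. \<phi> i a)"
      using M that
      by (metis enat_lim_eq_SUP matrix_prec_def count_list_0_iff enat_ord_simps(2)
          diff_less less_le_trans neq0_conv zero_less_one)
    then obtain i where "enat (count_list M a - 1) < \<phi> i a" by (auto simp: less_SUP_iff)
    then have "enat (Suc (count_list M a - 1)) \<le> \<phi> i a" by (simp add: Suc_ile_eq)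
    moreover have "count_list M a \<noteq> 0" using that by (simp add: count_list_0_iff)
    ultimately show ?thesis by auto
  qed
  then obtain k where k: "\<And>a. a \<in> set M \<Longrightarrow> enat (count_list M a) \<le> \<phi> (k a) a" by metis
  obtain i where i: "\<And>a. a \<in> set M \<Longrightarrow> k a \<le> i"
    using finite_nat_set_iff_bounded_le[of "k ` set M"] by auto
  have "enat (count_list M a) \<le> \<phi> i a" for a
  proof (cases "a \<in> set M")
    case True
    then show ?thesis using k i le order_trans by blast
  next
    case False
    then show ?thesis by (simp add: zero_enat_def[symmetric])
  qed
  then show thesis using that matrix_prec_def by blast
qed

lemma satisfies_limit:
  assumes "\<And>i. satisfies g (GConstraint m (\<phi> i) S)" "\<And>i. \<phi> i \<le> \<phi> (Suc i)"
  shows "satisfies g (GConstraint m (\<lambda>a. enat_lim (\<lambda>i. \<phi> i a)) S)"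
  unfolding satisfies_def using assms(1)
  by (auto simp: satisfies_def elim!: matrix_prec_limit[rotated] intro: assms(2))

lemma satisfies_conjunctive_minor:
  fixes c :: "'j \<Rightarrow> ('a, 'b) gconstraint" and V :: "'v set"
  assumes minor: "conjunctive_minor V J h c d" and sat: "\<And>j. j \<in> J \<Longrightarrow> satisfies g (c j)"
  shows "satisfies g d"
  unfolding satisfies_def
proof (intro ballI impI)
  let ?m = "arity d" and ?n = "fst g" and ?f = "snd g"
  fix M assume M: "M \<in> matrices ?m ?n" "M \<prec>\<^sub>m antecedent d"
  have h: "set (h j) \<subseteq> {..<?m} <+> V" "arity (c j) = length (h j)" if "j \<in> J" for j
    using minor that by (auto simp: conjunctive_minor_def minor_scheme_def)
  obtain \<sigma> :: "nat \<Rightarrow> 'v \<Rightarrow> 'a" where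
    \<sigma>: "\<And>j. j \<in> J \<Longrightarrow> map (\<lambda>k. map (M ! k +\<^sub>t \<sigma> k) (h j)) [0..<?n] \<prec>\<^sub>m antecedent (c j)"
    using minor M unfolding conjunctive_minor_def restrictive_minor_def by meson
  define b where "b = apply_rows ?f ?m M"
  \<comment> \<open>The Skolem maps over A, one per column, are combined by \<open>?f\<close> into a
    single one over B, exactly as \<open>b\<close> arises from the columns of \<open>M\<close>.
    Hence evaluating \<open>b +\<^sub>t \<tau>\<close> along \<open>h j\<close> amounts to applying
    \<open>?f\<close> to the rows of the j-th image matrix.\<close>
  define \<tau> where "\<tau> v = ?f (map (\<lambda>k. \<sigma> k v) [0..<?n])" for v
  have n: "length M = ?n" using M(1) by (simp add: matrices_def)
  have "map (b +\<^sub>t \<tau>) (h j) \<in> consequent (c j)" if j: "j \<in> J" for j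
  proof -
    let ?M = "map (\<lambda>k. map (M ! k +\<^sub>t \<sigma> k) (h j)) [0..<?n]"
    have val: "(b +\<^sub>t \<tau>) x = ?f (map (\<lambda>k. (M ! k +\<^sub>t \<sigma> k) x) [0..<?n])"
      if "x \<in> set (h j)" for x
    proof (cases x)
      case (Inl i)
      then have "i < ?m" using h(1)[OF j] that by auto
      moreover have "map (\<lambda>a. a ! i) M = map (\<lambda>k. M ! k ! i) [0..<?n]"
        by (rule nth_equalityI) (simp_all add: n)
      ultimately show ?thesis by (simp add: Inl extend_tuple_def b_def apply_rows_def)
    next
      case (Inr v)
      then show ?thesis by (simp add: extend_tuple_def \<tau>_def)
    qed
    have "map (b +\<^sub>t \<tau>) (h j) = apply_rows ?f (arity (c j)) ?M"
      by (rule nth_equalityI) (simp_all add: apply_rows_def h(2)[OF j] val comp_def)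
    moreover have "?M \<in> matrices (arity (c j)) ?n"
      by (auto simp: matrices_def tuples_def h(2)[OF j])
    ultimately show ?thesis using sat[OF j] \<sigma>[OF j] by (simp add: satisfies_def)
  qed
  moreover have "b \<in> tuples ?m" by (simp add: b_def apply_rows_def tuples_def)
  ultimately show "b \<in> consequent d"
    using minor unfolding conjunctive_minor_def extensive_minor_def by blast
qed

section \<open>Separating functions for antecedents that count columns\<close>

lemma closed_under_conjunctive_minors_zero_antecedent:
  assumes T: "closed_under_conjunctive_minors T" "unary_empty_constraint \<in> T"
    and c: "generalized_constraint c" "antecedent c = (\<lambda>_. 0)"
  shows "c \<in> T"
proof (rule closed_under_conjunctive_minorsD[OF T(1)])
  \<comment> \<open>The scheme picks out one target coordinate. The only matrix to check has no
    columns, and the empty source consequent makes the extensive condition vacuous.\<close>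
  show "conjunctive_minor ({} :: unit set) {()} (\<lambda>_. [Inl 0]) (\<lambda>_. unary_empty_constraint) c"
    unfolding conjunctive_minor_def
  proof (intro conjI)
    have empty: "M = []" if "M \<prec>\<^sub>m (\<lambda>_. 0)" for M :: "'a list list"
      using matrix_prec_nonzero[OF that] by (cases M) auto
    show "restrictive_minor (arity c) {()} (\<lambda>_. [Inl 0 :: nat + unit]) (antecedent c)
        (\<lambda>_. antecedent (unary_empty_constraint :: ('a, 'b) gconstraint))"
      unfolding restrictive_minor_def c(2)
    proof (intro allI ballI impI)
      fix n and M :: "'a list list"
      assume M: "M \<in> matrices (arity c) n" "M \<prec>\<^sub>m (\<lambda>_. 0)"
      from M(1) have "n = 0" by (simp add: empty[OF M(2)] matrices_def)
      then show "\<exists>\<sigma> :: nat \<Rightarrow> unit \<Rightarrow> 'a. \<forall>j \<in> {()}.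
          map (\<lambda>k. map (M ! k +\<^sub>t \<sigma> k) [Inl 0]) [0..<n]
            \<prec>\<^sub>m antecedent (unary_empty_constraint :: ('a, 'b) gconstraint)"
        by (simp add: matrix_prec_def zero_enat_def[symmetric])
    qed
  qed (use c(1) in \<open>auto simp: minor_scheme_def generalized_constraint_def extensive_minor_def
        unary_empty_constraint_def repetition_function_def\<close>)
qed (use T(2) in auto)

lemma separating_function_of_matrix:
  fixes T :: "('a, 'b) gconstraint set" and D :: "'a list list"
  assumes T: "\<And>c. c \<in> T \<Longrightarrow> generalized_constraint c" "binary_equality_constraint \<in> T"
      "closed_under_conjunctive_minors T"
    and D: "\<And>a. antecedent d a = enat (count_list D a)"
    and d: "generalized_constraint d" "d \<notin> T"
  obtains f where "f \<in> extensional (tuples (length D))"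
    "\<And>c. c \<in> T \<Longrightarrow> satisfies (length D, f) c" "\<not> satisfies (length D, f) d"
proof -
  let ?m = "arity d" and ?N = "length D"
  \<comment> \<open>Rows of matrices with \<open>?N\<close> columns are the indeterminates. Equal
    rows of different matrices are the same indeterminate, so a Skolem map assigns them the same
    value, as a function must.\<close>
  define row where "row M i = map (\<lambda>a. a ! i) M" for M :: "'a list list" and i
  define P where "P = {(c, M). c \<in> T \<and> M \<in> matrices (arity c) ?N \<and> M \<prec>\<^sub>m antecedent c}"
  \<comment> \<open>An index \<open>Inl i\<close> equates target coordinate \<open>i\<close> with
    the indeterminate \<open>row D i\<close>; an index \<open>Inr (c, M)\<close> imposes
    \<open>c\<close> on the rows of \<open>M\<close>.\<close>
  define J :: "(nat + ('a, 'b) gconstraint \<times> 'a list list) set" where "J = {..<?m} <+> P"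
  define h :: "nat + ('a, 'b) gconstraint \<times> 'a list list \<Rightarrow> (nat + 'a list) list" where
    "h = case_sum (\<lambda>i. [Inl i, Inr (row D i)]) (\<lambda>(c, M). map (\<lambda>i. Inr (row M i)) [0..<arity c])"
  define c where "c = case_sum (\<lambda>i :: nat. binary_equality_constraint)
    (fst :: _ \<times> 'a list list \<Rightarrow> ('a, 'b) gconstraint)"
  have D_prec: "D \<prec>\<^sub>m antecedent d" by (simp add: matrix_prec_def D)
  have D_mat: "D \<in> matrices ?m ?N"
  proof -
    have "a \<in> tuples ?m" if "a \<in> set D" for a
      using matrix_prec_nonzero[OF D_prec that] d(1)
      by (auto simp: generalized_constraint_def repetition_function_def)
    then show ?thesis by (auto simp: matrices_def)
  qed
  have c_T: "c j \<in> T" if "j \<in> J" for j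
    using that T(2) by (auto simp: J_def c_def P_def)
  have gc: "generalized_constraint (c j)" "arity (c j) = length (h j)" if "j \<in> J" for j
    using that T(1)[OF c_T[OF that]]
    by (auto simp: J_def c_def h_def binary_equality_constraint_def)
  have m: "?m \<ge> 1" using d(1) by (simp add: generalized_constraint_def)
  have scheme: "minor_scheme ?m (UNIV :: 'a list set) J h"
    unfolding minor_scheme_def
  proof (intro conjI ballI)
    have "Inl 0 \<in> J" using m by (auto simp: J_def)
    then show "J \<noteq> {}" by blast
    fix j assume j: "j \<in> J"
    show "length (h j) \<ge> 1" using gc[OF j] by (simp add: generalized_constraint_def)
    show "set (h j) \<subseteq> {..<?m} <+> UNIV" using j by (auto simp: J_def h_def)
  qed (rule m)
  have restr: "restrictive_minor ?m J h (antecedent d) (\<lambda>j. antecedent (c j))"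
    unfolding restrictive_minor_def
  proof (intro allI ballI impI)
    fix n and M :: "'a list list"
    assume M: "M \<in> matrices ?m n" "M \<prec>\<^sub>m antecedent d"
    then have n: "length M = n" by (simp add: matrices_def)
    have "\<And>a. count_list M a \<le> count_list D a" using M(2) by (simp add: matrix_prec_def D)
    then obtain \<pi> where \<pi>: "inj_on \<pi> {..<n}" "\<And>k. k < n \<Longrightarrow> \<pi> k < ?N"
      "\<And>k. k < n \<Longrightarrow> M ! k = D ! \<pi> k"
      using obtain_injection_of_count_list_le n by metis
    show "\<exists>\<sigma> :: nat \<Rightarrow> 'a list \<Rightarrow> 'a. \<forall>j \<in> J.
        map (\<lambda>k. map (M ! k +\<^sub>t \<sigma> k) (h j)) [0..<n] \<prec>\<^sub>m antecedent (c j)"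
    \<comment> \<open>The Skolem map for column \<open>k\<close> is the projection
      \<open>\<lambda>v. v ! \<pi> k\<close>, where \<open>\<pi> k\<close> is the position in
      \<open>D\<close> of that column.\<close>
    proof (intro exI ballI)
      fix j assume "j \<in> J"
      then consider i where "j = Inl i" "i < ?m" | e M' where "j = Inr (e, M')" "(e, M') \<in> P"
        by (auto simp: J_def)
      then show "map (\<lambda>k. map (M ! k +\<^sub>t (\<lambda>v. v ! \<pi> k)) (h j)) [0..<n] \<prec>\<^sub>m antecedent (c j)"
      proof cases
        case 1
        then have "map (\<lambda>k. map (M ! k +\<^sub>t (\<lambda>v. v ! \<pi> k)) (h j)) [0..<n] =
            map (\<lambda>k. [M ! k ! i, M ! k ! i]) [0..<n]"
          using \<pi> by (simp add: h_def extend_tuple_def row_def)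
        then show ?thesis
          using 1 by (auto simp: c_def matrix_prec_def binary_equality_constraint_def
              zero_enat_def count_list_0_iff)
      next
        case 2
        then have M': "M' \<in> matrices (arity e) ?N" "M' \<prec>\<^sub>m antecedent e" by (auto simp: P_def)
        then have len: "length M' = ?N" by (simp add: matrices_def)
        \<comment> \<open>Projecting all rows of \<open>M'\<close> to coordinate
          \<open>\<pi> k\<close> yields its column there. By injectivity of \<open>\<pi>\<close>,
          the image matrix uses each column position of \<open>M'\<close> at most once.\<close>
        have "map (M ! k +\<^sub>t (\<lambda>v. v ! \<pi> k)) (h j) = M' ! \<pi> k" if "k < n" for k
        proof (rule nth_equalityI)
          have "M' ! \<pi> k \<in> tuples (arity e)"
            using M'(1) \<pi>(2)[OF that] by (auto simp: matrices_def)
          then show "length (map (M ! k +\<^sub>t (\<lambda>v. v ! \<pi> k)) (h j)) = length (M' ! \<pi> k)"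
            using 2 by (simp add: h_def tuples_def)
        qed (use 2 \<pi>(2)[OF that] len in \<open>simp add: h_def extend_tuple_def row_def\<close>)
        then have eq: "map (\<lambda>k. map (M ! k +\<^sub>t (\<lambda>v. v ! \<pi> k)) (h j)) [0..<n] =
            map (\<lambda>k. M' ! \<pi> k) [0..<n]"
          by simp
        have "count_list (map (\<lambda>k. M' ! \<pi> k) [0..<n]) a \<le> count_list M' a" for a
          by (rule count_list_select_le) (use \<pi> len in auto)
        then show ?thesis
          using M'(2) 2 unfolding eq matrix_prec_def
          by (simp add: c_def) (meson enat_ord_simps(1) order_trans)
      qed
    qed
  qed
  \<comment> \<open>All other requirements on a minor hold, so the extensive one must fail; the
    Skolem map witnessing the failure is the separating function.\<close>
  have "\<not> conjunctive_minor UNIV J h c d"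
    using closed_under_conjunctive_minorsD[OF T(3), of J c UNIV h d] c_T d(2) by blast
  then have "\<not> extensive_minor ?m J h (consequent d) (\<lambda>j. consequent (c j))"
    using scheme restr gc d(1) by (simp add: conjunctive_minor_def)
  then obtain b and \<sigma> :: "'a list \<Rightarrow> 'b" where b: "b \<in> tuples ?m" "b \<notin> consequent d"
    and \<sigma>: "\<And>j. j \<in> J \<Longrightarrow> map (b +\<^sub>t \<sigma>) (h j) \<in> consequent (c j)"
    by (auto simp: extensive_minor_def)
  \<comment> \<open>Restriction makes \<open>f\<close> extensional and keeps the values at rows,
    which have length \<open>?N\<close>.\<close>
  define f where "f = restrict \<sigma> (tuples ?N)"
  have rows: "apply_rows f k M = map (\<lambda>i. \<sigma> (row M i)) [0..<k]" if "M \<in> matrices k ?N" for k M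
    using that by (simp add: apply_rows_def f_def row_def tuples_def matrices_def)
  show thesis
  proof
    show "f \<in> extensional (tuples ?N)" by (simp add: f_def)
    show "satisfies (?N, f) e" if "e \<in> T" for e
      unfolding satisfies_def
    proof (intro ballI impI)
      fix M assume M: "M \<in> matrices (arity e) (fst (?N, f))" "M \<prec>\<^sub>m antecedent e"
      then have "Inr (e, M) \<in> J" using that by (auto simp: J_def P_def)
      from \<sigma>[OF this] show "apply_rows (snd (?N, f)) (arity e) M \<in> consequent e"
        using M(1) by (simp add: h_def c_def extend_tuple_def rows comp_def)
    qed
    \<comment> \<open>The equality constraints identify \<open>b\<close>, which lies outside the
      consequent, with the image of \<open>D\<close>.\<close>
    have "b ! i = \<sigma> (row D i)" if "i < ?m" for i
    proof -
      have "Inl i \<in> J" using that by (auto simp: J_def)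
      from \<sigma>[OF this] show ?thesis
        by (auto simp: h_def c_def extend_tuple_def binary_equality_constraint_def)
    qed
    then have "apply_rows f ?m D = b"
      using b(1) unfolding rows[OF D_mat] by (auto intro!: nth_equalityI simp: tuples_def)
    then show "\<not> satisfies (?N, f) d"
      using b(2) D_mat D_prec by (auto simp: satisfies_def)
  qed
qed

section \<open>Reduction to antecedents that count the columns of one matrix\<close>

lemma enat_lim_min_of_nat: "enat_lim (\<lambda>i. min x (enat i)) = x"
proof (cases x)
  case (enat k)
  show ?thesis unfolding enat_lim_eq_SUP
  proof (rule antisym)
    have "x = min x (enat k)" by (simp add: enat)
    also have "\<dots> \<le> (SUP i. min x (enat i))" by (rule SUP_upper) simp
    finally show "x \<le> (SUP i. min x (enat i))" .
  qed (auto intro: SUP_least)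
next
  case infinity
  have "enat k \<le> (SUP i. enat i)" for k by (rule SUP_upper) simp
  then have "(SUP i. enat i) = \<infinity>" by (metis Suc_ile_eq enat.exhaust less_irrefl)
  then show ?thesis by (simp add: infinity enat_lim_eq_SUP)
qed

text \<open>Local closure gives a finite support outside \<open>T\<close>, and closure under limits
  then gives finite values. A finitely supported function into the naturals counts the entries of
  some list.\<close>

lemma obtain_counting_constraint:
  fixes T :: "('a, 'b) gconstraint set"
  assumes T: "locally_closed T" "closed_under_limits T"
    and c: "generalized_constraint c" "c \<notin> T"
  obtains d D where "generalized_constraint d" "d \<notin> T" "arity d = arity c"
    "consequent d = consequent c" "antecedent d \<le> antecedent c"
    "\<And>a. antecedent d a = enat (count_list D a)"
proof -
  obtain c' where c': "finite_restriction c' c" "c' \<notin> T"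
    using T(1) c by (auto simp: locally_closed_def)
  obtain m \<phi> S where eq: "c' = GConstraint m \<phi> S" by (cases c')
  have gc: "generalized_constraint c'" and
    m: "arity c = m" "consequent c = S" "\<phi> \<le> antecedent c" "finite {a \<in> tuples m. \<phi> a \<noteq> 0}"
    using c'(1) by (auto simp: finite_restriction_def eq)
  have "{a \<in> tuples m. \<phi> a \<noteq> 0} = {a. \<phi> a \<noteq> 0}"
    using gc by (auto simp: generalized_constraint_def repetition_function_def eq)
  with m(4) have fin: "finite {a. \<phi> a \<noteq> 0}" by simp
  \<comment> \<open>The truncations at \<open>i\<close> increase to \<open>\<phi>\<close>; if all of
    them were in \<open>T\<close>, then so would be \<open>c'\<close>.\<close>
  define \<psi> where "\<psi> i a = min (\<phi> a) (enat i)" for i a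
  have "\<psi> i \<le> \<psi> (Suc i)" for i
    by (simp add: \<psi>_def le_fun_def min.coboundedI2)
  moreover have "(\<lambda>a. enat_lim (\<lambda>i. \<psi> i a)) = \<phi>" by (simp add: \<psi>_def enat_lim_min_of_nat)
  ultimately obtain i where i: "GConstraint m (\<psi> i) S \<notin> T"
    using T(2)[unfolded closed_under_limits_def, rule_format, of m \<psi> S] c'(2)
    unfolding eq by auto
  have finite_val: "\<psi> i a = enat (the_enat (\<psi> i a))" for a
    by (cases "\<phi> a") (simp_all add: \<psi>_def)
  have "finite {a. the_enat (\<psi> i a) \<noteq> 0}"
    by (rule finite_subset[OF _ fin]) (auto simp: \<psi>_def zero_enat_def)
  then obtain D where "\<And>a. count_list D a = the_enat (\<psi> i a)"
    using obtain_list_of_counts[of "\<lambda>a. the_enat (\<psi> i a)"] by blast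
  with finite_val have "\<And>a. \<psi> i a = enat (count_list D a)" by metis
  moreover have "generalized_constraint (GConstraint m (\<psi> i) S)"
    using gc by (auto simp: generalized_constraint_def repetition_function_def eq \<psi>_def)
  moreover have "\<psi> i \<le> antecedent c"
    using m(3) by (auto simp: \<psi>_def le_fun_def intro: min.coboundedI1)
  ultimately show thesis using that[of "GConstraint m (\<psi> i) S" D] i m by simp
qed

lemma satisfies_antecedent_mono:
  assumes "satisfies g c" "arity d = arity c" "consequent d = consequent c"
    "antecedent d \<le> antecedent c"
  shows "satisfies g d"
  using assms unfolding satisfies_def matrix_prec_def le_fun_def by (metis order_trans)

lemma separating_function:
  fixes T :: "('a, 'b) gconstraint set"
  assumes T: "\<And>c. c \<in> T \<Longrightarrow> generalized_constraint c" "locally_closed T"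
      "binary_equality_constraint \<in> T" "unary_empty_constraint \<in> T"
      "closed_under_conjunctive_minors T" "closed_under_limits T"
    and c: "generalized_constraint c" "c \<notin> T"
  obtains g where "g \<in> several_variable_funs" "\<And>e. e \<in> T \<Longrightarrow> satisfies g e" "\<not> satisfies g c"
proof -
  obtain d D where d: "generalized_constraint d" "d \<notin> T" "arity d = arity c"
      "consequent d = consequent c" "antecedent d \<le> antecedent c"
    and D: "\<And>a. antecedent d a = enat (count_list D a)"
    using obtain_counting_constraint[OF T(2,6) c] by blast
  \<comment> \<open>The length of \<open>D\<close> becomes the arity of the separating function, so
    it has to be positive.\<close>
  have "D \<noteq> []"
  proof
    assume "D = []"
    then have "antecedent d = (\<lambda>_. 0)" by (simp add: D fun_eq_iff zero_enat_def)
    with closed_under_conjunctive_minors_zero_antecedent[OF T(5,4) d(1)] d(2) show False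
      by blast
  qed
  obtain f where f: "f \<in> extensional (tuples (length D))"
    "\<And>e. e \<in> T \<Longrightarrow> satisfies (length D, f) e" "\<not> satisfies (length D, f) d"
    using separating_function_of_matrix[OF T(1,3,5) D d(1,2)] by blast
  have "(length D, f) \<in> several_variable_funs"
    using f(1) \<open>D \<noteq> []\<close> by (simp add: several_variable_funs_def Suc_le_eq)
  moreover have "\<not> satisfies (length D, f) c"
    using satisfies_antecedent_mono d(3-5) f(3) by blast
  ultimately show thesis using that f(2) by blast
qed

theorem theorem4p5:
  fixes T :: "('a, 'b) gconstraint set"
  assumes "\<forall>c \<in> T. generalized_constraint c"
  shows "(locally_closed T \<and> binary_equality_constraint \<in> T \<and> unary_empty_constraint \<in> T \<and>
          closed_under_conjunctive_minors T \<and> closed_under_limits T)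
     \<longleftrightarrow> (\<exists>C :: ('a, 'b) mfun set. C \<subseteq> several_variable_funs \<and> characterized_by T C)"
    (is "?L \<longleftrightarrow> ?R")
proof
  assume L: ?L
  \<comment> \<open>The largest candidate: every function satisfying all of \<open>T\<close>. A
    constraint outside \<open>T\<close> is violated by a separating function, which belongs to this
    set.\<close>
  let ?C = "{g \<in> several_variable_funs. \<forall>c \<in> T. satisfies g c}"
  have "c \<in> T" if "generalized_constraint c" "\<forall>g \<in> ?C. satisfies g c" for c
  proof (rule ccontr)
    assume "c \<notin> T"
    with L assms that(1) obtain g
      where "g \<in> several_variable_funs" "\<And>e. e \<in> T \<Longrightarrow> satisfies g e" "\<not> satisfies g c"
      by (metis separating_function)
    with that(2) show False by blast
  qed
  then have "characterized_by T ?C" using assms by (auto simp: characterized_by_def)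
  then show ?R by (intro exI[of _ ?C]) auto
next
  assume ?R
  then obtain C :: "('a, 'b) mfun set" where C: "C \<subseteq> several_variable_funs"
    and "characterized_by T C"
    by (elim exE conjE)
  then have T: "T = {c. generalized_constraint c \<and> (\<forall>g \<in> C. satisfies g c)}"
    by (simp only: characterized_by_def)
  show ?L
  proof (intro conjI)
    show "locally_closed T"
      unfolding locally_closed_def T using satisfies_if_finite_restrictions by blast
    show "binary_equality_constraint \<in> T"
      using satisfies_binary_equality
      by (auto simp: T generalized_constraint_def binary_equality_constraint_def
          repetition_function_def tuples_def)
    have "satisfies g unary_empty_constraint" if "g \<in> C" for g
      using C that by (intro satisfies_unary_empty) (auto simp: several_variable_funs_def)
    moreover have "generalized_constraint unary_empty_constraint"
      by (simp add: generalized_constraint_def unary_empty_constraint_def repetition_function_def)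
    ultimately show "unary_empty_constraint \<in> T" by (simp add: T)
    show "closed_under_conjunctive_minors T"
      unfolding closed_under_conjunctive_minors_def
    proof (intro allI impI)
      fix V :: "'a indet set" and J :: "('a, 'b) index set" and h c d
      assume c: "\<forall>j \<in> J. c j \<in> T" and minor: "conjunctive_minor V J h c d"
      have "satisfies g d" if "g \<in> C" for g
        by (rule satisfies_conjunctive_minor[OF minor]) (use c that in \<open>auto simp: T\<close>)
      moreover have "generalized_constraint d" using minor by (simp add: conjunctive_minor_def)
      ultimately show "d \<in> T" by (simp add: T)
    qed
    show "closed_under_limits T"
      unfolding closed_under_limits_def
    proof (intro allI impI)
      fix m \<phi> S
      assume \<phi>: "\<forall>i. GConstraint m (\<phi> i) S \<in> T" "\<forall>i :: nat. \<phi> i \<le> \<phi> (Suc i)"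
      let ?d = "GConstraint m (\<lambda>a. enat_lim (\<lambda>i. \<phi> i a)) S"
      have "satisfies g ?d" if "g \<in> C" for g
        using \<phi> that by (intro satisfies_limit) (auto simp: T)
      moreover have "generalized_constraint ?d"
        using \<phi>(1) by (auto simp: T generalized_constraint_def repetition_function_def
            enat_lim_eq_SUP)
      ultimately show "?d \<in> T" by (simp add: T)
    qed
  qed
qed

end
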